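(* For all integers $m\ge 0$ and $n\ge 1$, writing $U_k=T_{k}^{(s_{1,0}^{(n)},s_{1,1}^{(n)},s_{1,2}^{(n)})}$ and $V^{(j)}_k=T_{k}^{(s_{1,0}^{(jn)},s_{1,1}^{(jn)},s_{1,2}^{(jn)})}$ for $j=2,3,4$, \begin{align*} \frac{1}{(A_1^{(n)})^4}\sum_{\substack{k_1+k_2+k_3+k_4=m\\ k_1,k_2,k_3,k_4\ge 0}}\binom{m}{k_1,k_2,k_3,k_4}U_{k_1}U_{k_2}U_{k_3}U_{k_4} &=-\frac{6\cdot 4^m}{A_1^{(4n)}}V^{(4)}_m +\frac{4}{A_1^{(3n)} A_1^{(n)}}\sum_{k=0}^m\binom{m}{k}3^{k}V^{(3)}_k U_{m-k}\\ &\quad +\frac{3}{(A_1^{(2n)})^2}\sum_{k=0}^m\binom{m}{k}2^{m}V^{(2)}_kV^{(2)}_{m-k} +\frac{12}{44^nA_1^{(n)}}\sum_{k=0}^m\binom{m}{k}U_k. \end{align*}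
   Context: Let $\alpha,\beta,\gamma$ be the three distinct complex roots of $x^3-x^2-x-1=0$, and set $c_1=\frac{\alpha}{(\alpha-\beta)(\alpha-\gamma)}$, $c_2=\frac{\beta}{(\beta-\alpha)(\beta-\gamma)}$, $c_3=\frac{\gamma}{(\gamma-\alpha)(\gamma-\beta)}$. For numbers $s_0,s_1,s_2$, the sequence $T_k^{(s_0,s_1,s_2)}$ is defined by $T_0^{(s_0,s_1,s_2)}=s_0$, $T_1^{(s_0,s_1,s_2)}=s_1$, $T_2^{(s_0,s_1,s_2)}=s_2$ and $T_k^{(s_0,s_1,s_2)}=T_{k-1}^{(s_0,s_1,s_2)}+T_{k-2}^{(s_0,s_1,s_2)}+T_{k-3}^{(s_0,s_1,s_2)}$ for $k\ge3$. For each integer $N\ge1$, let $A_1^{(N)}\neq0$ and $s_{1,0}^{(N)},s_{1,1}^{(N)},s_{1,2}^{(N)}$ be numbers such that $c_1^Ne^{\alpha x}+c_2^Ne^{\beta x}+c_3^Ne^{\gamma x}=\frac{1}{A_1^{(N)}}\sum_{k\ge0}T_k^{(s_{1,0}^{(N)},s_{1,1}^{(N)},s_{1,2}^{(N)})}\frac{x^k}{k!}$ (in the paper these are specific integer normalizations). $\binom{m}{k_1,\dots,k_r}=\frac{m!}{k_1!\cdots k_r!}$ is the multinomial coefficient. *)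

theory Defs
  imports "HOL-Analysis.Analysis"
begin

fun tribonacci :: "'a::plus \<Rightarrow> 'a \<Rightarrow> 'a \<Rightarrow> nat \<Rightarrow> 'a" where
  "tribonacci s0 s1 s2 0 = s0"
| "tribonacci s0 s1 s2 (Suc 0) = s1"
| "tribonacci s0 s1 s2 (Suc (Suc 0)) = s2"
| "tribonacci s0 s1 s2 (Suc (Suc (Suc k))) =
     tribonacci s0 s1 s2 (Suc (Suc k)) + tribonacci s0 s1 s2 (Suc k) + tribonacci s0 s1 s2 k"

text \<open>The quotient is meant for lists \<open>ks\<close> with \<open>sum_list ks = m\<close>.\<close>

definition multinomial :: "nat \<Rightarrow> nat list \<Rightarrow> 'a::field_char_0" where
  "multinomial m ks = fact m / (\<Prod>k\<leftarrow>ks. fact k)"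

end

theory Submission
  imports Defs
begin

text \<open>
  With \<open>a = c1 ^ n * exp (\<alpha> x)\<close>, and \<open>b\<close>, \<open>c\<close> likewise, the exponential generating functions of
  \<open>U\<close> and of \<open>k \<mapsto> j ^ k * V j k\<close> are, up to the normalizing constants, the power sums
  \<open>a + b + c\<close> and \<open>a ^ j + b ^ j + c ^ j\<close>. By Vieta \<open>\<alpha> + \<beta> + \<gamma> = 1\<close>, and \<open>c1 * c2 * c3 = 1 / 44\<close> because
  the cubic has discriminant \<open>-44\<close>; hence \<open>a * b * c = exp x / 44 ^ n\<close>. The theorem is the
  \<open>m\<close>-th coefficient of Newton's identity \<open>p1^4 = -6 p4 + 4 p3 p1 + 3 p2^2 + 12 a b c p1\<close>.
\<close>

definition egf :: "(nat \<Rightarrow> 'a::field_char_0) \<Rightarrow> 'a fps" where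
  "egf f = Abs_fps (\<lambda>k. f k / fact k)"

lemma egf_nth [simp]: "fps_nth (egf f) k = f k / fact k"
  by (simp add: egf_def)

lemma egf_powers: "egf (\<lambda>k. a ^ k) = fps_exp a"
  by (simp add: fps_eq_iff)

text \<open>The factorials in \<open>fact m / (fact k * fact (m - k))\<close> combine to a binomial
  coefficient, so products of such series are binomial convolutions.\<close>

lemma fact_mult_egf_mult_nth:
  "fact m * fps_nth (egf f * egf g) m = (\<Sum>k=0..m. of_nat (m choose k) * f k * g (m - k))"
  by (auto simp: fps_mult_nth sum_distrib_left binomial_fact intro!: sum.cong)

lemma fps_mult4_nth:
  fixes f g h w :: "'a::comm_semiring_1 fps"
  shows "fps_nth (f * g * h * w) m =
    (\<Sum>(k1, k2, k3, k4) \<in> {(k1, k2, k3, k4). k1 + k2 + k3 + k4 = m}.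
      fps_nth f k1 * fps_nth g k2 * fps_nth h k3 * fps_nth w k4)"
proof -
  have "fps_nth (f * (g * (h * w))) m =
      (\<Sum>k1=0..m. \<Sum>k2=0..m-k1. \<Sum>k3=0..m-k1-k2.
        fps_nth f k1 * fps_nth g k2 * fps_nth h k3 * fps_nth w (m-k1-k2-k3))"
    by (simp add: fps_mult_nth sum_distrib_left mult.assoc)
  also have "\<dots> = (\<Sum>(k1, k2, k3) \<in> (SIGMA k1:{0..m}. SIGMA k2:{0..m-k1}. {0..m-k1-k2}).
        fps_nth f k1 * fps_nth g k2 * fps_nth h k3 * fps_nth w (m-k1-k2-k3))"
    by (simp add: sum.Sigma)
  also have "\<dots> = (\<Sum>(k1, k2, k3, k4) \<in> {(k1, k2, k3, k4). k1 + k2 + k3 + k4 = m}.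
      fps_nth f k1 * fps_nth g k2 * fps_nth h k3 * fps_nth w k4)"
    \<comment> \<open>The fourth index is forced by the other three; the summation ranges keep the
      truncated subtraction exact.\<close>
    by (rule sum.reindex_bij_witness[where i = "\<lambda>(k1, k2, k3, k4). (k1, k2, k3)"
          and j = "\<lambda>(k1, k2, k3). (k1, k2, k3, m-k1-k2-k3)"]) auto
  finally show ?thesis
    by (simp add: mult.assoc)
qed

lemma fact_mult_egf_mult4_nth:
  "fact m * fps_nth (egf f * egf g * egf h * egf w) m =
    (\<Sum>(k1, k2, k3, k4) \<in> {(k1, k2, k3, k4). k1 + k2 + k3 + k4 = m}.
      multinomial m [k1, k2, k3, k4] * f k1 * g k2 * h k3 * w k4)"
  unfolding fps_mult4_nth sum_distrib_left
  by (rule sum.cong) (auto simp: multinomial_def mult.assoc)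

text \<open>Uniqueness of power series coefficients: both series have positive radius of convergence
  and the same values near 0. This turns the analytic hypothesis \<open>gen\<close> into a Binet
  formula.\<close>

lemma power_series_eq_exp_sum_imp_coeff:
  fixes f :: "nat \<Rightarrow> complex"
  assumes "\<And>x. (\<lambda>k. f k * x ^ k) sums (u * exp (\<alpha> * x) + v * exp (\<beta> * x) + w * exp (\<gamma> * x))"
  shows "f k = (u * \<alpha> ^ k + v * \<beta> ^ k + w * \<gamma> ^ k) / fact k"
proof -
  let ?G = "fps_const u * fps_exp \<alpha> + fps_const v * fps_exp \<beta> + fps_const w * fps_exp \<gamma>"
  let ?g = "\<lambda>x. u * exp (\<alpha> * x) + v * exp (\<beta> * x) + w * exp (\<gamma> * x)"
  have G: "?g has_fps_expansion ?G"
    by (intro fps_expansion_intros)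
  have "Abs_fps f = ?G"
  proof (rule eval_fps_eqD)
    show "fps_conv_radius (Abs_fps f) > 0"
      using conv_radius_inftyI''[OF sums_summable[OF assms]] by (simp add: fps_conv_radius_def)
    show "fps_conv_radius ?G > 0"
      using G by (simp add: has_fps_expansion_def)
    have "eval_fps (Abs_fps f) = ?g"
      using assms by (simp add: fun_eq_iff eval_fps_def sums_iff)
    then show "eventually (\<lambda>z. eval_fps (Abs_fps f) z = eval_fps ?G z) (nhds 0)"
      using G by (auto simp: has_fps_expansion_def elim: eventually_mono)
  qed
  then have "fps_nth (Abs_fps f) k = fps_nth ?G k"
    by simp
  then show ?thesis
    by (simp add: add_divide_distrib)
qed

lemma tribonacci_vieta:
  fixes \<alpha> \<beta> \<gamma> :: "'a::field"
  assumes "\<alpha> ^ 3 - \<alpha> ^ 2 - \<alpha> - 1 = 0" "\<beta> ^ 3 - \<beta> ^ 2 - \<beta> - 1 = 0" "\<gamma> ^ 3 - \<gamma> ^ 2 - \<gamma> - 1 = 0"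
    and "\<alpha> \<noteq> \<beta>" "\<alpha> \<noteq> \<gamma>" "\<beta> \<noteq> \<gamma>"
  shows "\<alpha> + \<beta> + \<gamma> = 1" "\<alpha> * \<beta> + \<alpha> * \<gamma> + \<beta> * \<gamma> = -1" "\<alpha> * \<beta> * \<gamma> = 1"
proof -
  \<comment> \<open>The difference of the cubic at two roots, factored; distinctness cancels the
    linear factor. Subtracting \<open>ac\<close> from \<open>ab\<close> below repeats the trick and
    leaves a linear relation.\<close>
  have "(\<alpha> - \<beta>) * (\<alpha>\<^sup>2 + \<alpha> * \<beta> + \<beta>\<^sup>2 - (\<alpha> + \<beta>) - 1) = 0"
    using assms(1,2) by algebra
  then have ab: "\<alpha>\<^sup>2 + \<alpha> * \<beta> + \<beta>\<^sup>2 - (\<alpha> + \<beta>) - 1 = 0"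
    using assms by simp
  have "(\<alpha> - \<gamma>) * (\<alpha>\<^sup>2 + \<alpha> * \<gamma> + \<gamma>\<^sup>2 - (\<alpha> + \<gamma>) - 1) = 0"
    using assms(1,3) by algebra
  then have ac: "\<alpha>\<^sup>2 + \<alpha> * \<gamma> + \<gamma>\<^sup>2 - (\<alpha> + \<gamma>) - 1 = 0"
    using assms by simp
  have "(\<beta> - \<gamma>) * (\<alpha> + \<beta> + \<gamma> - 1) = 0"
    using ab ac by algebra
  then show e1: "\<alpha> + \<beta> + \<gamma> = 1"
    using assms by simp
  show e2: "\<alpha> * \<beta> + \<alpha> * \<gamma> + \<beta> * \<gamma> = -1"
    using ab e1 by algebra
  show "\<alpha> * \<beta> * \<gamma> = 1"
    using assms(1) e1 e2 by algebra
qed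

text \<open>Each difference of roots occurs once with either sign, so the denominators multiply to
  minus the discriminant, which is 44. If \<open>44 = 0\<close> in the field, both sides are 0 by
  the convention for division by zero.\<close>

lemma tribonacci_weights_prod:
  fixes \<alpha> \<beta> \<gamma> :: "'a::field"
  assumes e1: "\<alpha> + \<beta> + \<gamma> = 1" and e2: "\<alpha> * \<beta> + \<alpha> * \<gamma> + \<beta> * \<gamma> = -1" and e3: "\<alpha> * \<beta> * \<gamma> = 1"
  shows "\<alpha> / ((\<alpha> - \<beta>) * (\<alpha> - \<gamma>)) * (\<beta> / ((\<beta> - \<alpha>) * (\<beta> - \<gamma>))) * (\<gamma> / ((\<gamma> - \<alpha>) * (\<gamma> - \<beta>))) = 1 / 44"
proof -
  have "(\<alpha> - \<beta>) * (\<alpha> - \<gamma>) * ((\<beta> - \<alpha>) * (\<beta> - \<gamma>)) * ((\<gamma> - \<alpha>) * (\<gamma> - \<beta>)) = 44"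
    using assms by algebra
  with e3 show ?thesis
    by (simp add: times_divide_times_eq)
qed

text \<open>With power sums \<open>pj\<close>, three variables satisfy
  \<open>p1^4 - 6 p1^2 p2 + 3 p2^2 + 8 p1 p3 - 6 p4 = 0\<close>, since \<open>e4 = 0\<close>.
  Eliminating \<open>p1^2 p2\<close> through \<open>6 a b c = p1^3 - 3 p1 p2 + 2 p3\<close> gives
  this form.\<close>

lemma power_sum_identity:
  fixes a b c :: "'a::comm_ring_1"
  shows "(a + b + c) * (a + b + c) * (a + b + c) * (a + b + c) =
    - 6 * (a ^ 4 + b ^ 4 + c ^ 4) + 4 * ((a ^ 3 + b ^ 3 + c ^ 3) * (a + b + c))
      + 3 * ((a ^ 2 + b ^ 2 + c ^ 2) * (a ^ 2 + b ^ 2 + c ^ 2)) + 12 * (a * b * c * (a + b + c))"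
  by (simp add: algebra_simps eval_nat_numeral)

theorem theorem9:
  fixes \<alpha> \<beta> \<gamma> c1 c2 c3 :: complex
    and A s0 s1 s2 :: "nat \<Rightarrow> complex"
    and U :: "nat \<Rightarrow> complex" and V :: "nat \<Rightarrow> nat \<Rightarrow> complex"
    and m n :: nat
  assumes roots: "{x::complex. x ^ 3 - x ^ 2 - x - 1 = 0} = {\<alpha>, \<beta>, \<gamma>}"
    and distinct: "\<alpha> \<noteq> \<beta>" "\<alpha> \<noteq> \<gamma>" "\<beta> \<noteq> \<gamma>"
    and c1: "c1 = \<alpha> / ((\<alpha> - \<beta>) * (\<alpha> - \<gamma>))"
    and c2: "c2 = \<beta> / ((\<beta> - \<alpha>) * (\<beta> - \<gamma>))"
    and c3: "c3 = \<gamma> / ((\<gamma> - \<alpha>) * (\<gamma> - \<beta>))"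
    and A_nonzero: "\<And>N. N \<ge> 1 \<Longrightarrow> A N \<noteq> 0"
    and gen: "\<And>N x. N \<ge> 1 \<Longrightarrow>
      (\<lambda>k. 1 / A N * (tribonacci (s0 N) (s1 N) (s2 N) k * (x ^ k / fact k))) sums
      (c1 ^ N * exp (\<alpha> * x) + c2 ^ N * exp (\<beta> * x) + c3 ^ N * exp (\<gamma> * x))"
    and n: "n \<ge> 1"
    and U: "\<And>k. U k = tribonacci (s0 n) (s1 n) (s2 n) k"
    and V: "\<And>j k. j \<in> {2, 3, 4} \<Longrightarrow>
      V j k = tribonacci (s0 (j * n)) (s1 (j * n)) (s2 (j * n)) k"
  shows "1 / A n ^ 4 *
      (\<Sum>(k1, k2, k3, k4) \<in> {(k1, k2, k3, k4). k1 + k2 + k3 + k4 = m}.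
        multinomial m [k1, k2, k3, k4] * U k1 * U k2 * U k3 * U k4)
    = - (6 * 4 ^ m / A (4 * n)) * V 4 m
      + 4 / (A (3 * n) * A n) * (\<Sum>k=0..m. of_nat (m choose k) * 3 ^ k * V 3 k * U (m - k))
      + 3 / (A (2 * n)) ^ 2 * (\<Sum>k=0..m. of_nat (m choose k) * 2 ^ m * V 2 k * V 2 (m - k))
      + 12 / (44 ^ n * A n) * (\<Sum>k=0..m. of_nat (m choose k) * U k)"
proof -
  have "\<alpha> \<in> {x. x ^ 3 - x ^ 2 - x - 1 = 0}" "\<beta> \<in> {x. x ^ 3 - x ^ 2 - x - 1 = 0}"
    "\<gamma> \<in> {x. x ^ 3 - x ^ 2 - x - 1 = 0}"
    unfolding roots by auto
  then have root: "\<alpha> ^ 3 - \<alpha> ^ 2 - \<alpha> - 1 = 0" "\<beta> ^ 3 - \<beta> ^ 2 - \<beta> - 1 = 0"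
    "\<gamma> ^ 3 - \<gamma> ^ 2 - \<gamma> - 1 = 0"
    by auto
  note vieta = tribonacci_vieta[OF root distinct]
  have c_prod: "c1 * c2 * c3 = 1 / 44"
    unfolding c1 c2 c3 by (rule tribonacci_weights_prod[OF vieta])

  \<comment> \<open>Dividing by \<open>A N\<close> makes the Binet formula free of normalizing
    constants.\<close>
  define W where "W N k = tribonacci (s0 N) (s1 N) (s2 N) k / A N" for N k
  have W: "W N k = c1 ^ N * \<alpha> ^ k + c2 ^ N * \<beta> ^ k + c3 ^ N * \<gamma> ^ k" if "N \<ge> 1" for N k
  proof -
    have "(\<lambda>k. W N k / fact k * x ^ k) sums
        (c1 ^ N * exp (\<alpha> * x) + c2 ^ N * exp (\<beta> * x) + c3 ^ N * exp (\<gamma> * x))" for x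
      using gen[OF that, of x] by (simp add: W_def mult_ac)
    from power_series_eq_exp_sum_imp_coeff[OF this, of k] show ?thesis
      by simp
  qed

  define a where "a = fps_const (c1 ^ n) * fps_exp \<alpha>"
  define b where "b = fps_const (c2 ^ n) * fps_exp \<beta>"
  define c where "c = fps_const (c3 ^ n) * fps_exp \<gamma>"
  \<comment> \<open>The \<open>j\<close>-th power sends the weight \<open>c1 ^ n\<close> to
    \<open>c1 ^ (j * n)\<close> and the exponent \<open>\<alpha>\<close> to
    \<open>j * \<alpha>\<close>; the latter produces the factor \<open>j ^ k\<close>.\<close>
  have power_sum: "egf (\<lambda>k. of_nat j ^ k * W (j * n) k) = a ^ j + b ^ j + c ^ j" if "j \<ge> 1" for j
  proof -
    have pow: "(fps_const (x ^ n) * fps_exp y) ^ j = fps_const (x ^ (j * n)) * fps_exp (of_nat j * y)"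
      for x y :: complex
      unfolding power_mult_distrib fps_exp_power_mult fps_const_power power_mult[symmetric]
      by (simp only: mult.commute[of n j])
    have "j * n \<ge> 1"
      using that n by simp
    then show ?thesis
      unfolding a_def b_def c_def pow
      by (intro fps_ext) (simp add: W power_mult_distrib add_divide_distrib distrib_left mult_ac)
  qed
  have P1: "egf (W n) = a + b + c"
    using power_sum[of 1] by simp
  \<comment> \<open>The exponents add up to 1, and \<open>exp x\<close> has the constant sequence 1
    behind it. This is why the last sum of the theorem contains \<open>U\<close> alone.\<close>
  have abc: "a * b * c = fps_const (1 / 44 ^ n) * egf (\<lambda>_. 1)"
  proof -
    have "a * b * c = fps_const ((c1 * c2 * c3) ^ n) * (fps_exp \<alpha> * fps_exp \<beta> * fps_exp \<gamma>)"
      by (simp add: a_def b_def c_def power_mult_distrib mult_ac flip: fps_const_mult)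
    also have "fps_exp \<alpha> * fps_exp \<beta> * fps_exp \<gamma> = fps_exp 1"
      by (simp add: vieta(1) flip: fps_exp_add_mult)
    finally show ?thesis
      by (simp add: c_prod power_one_over flip: egf_powers)
  qed

  let ?P = "\<lambda>j. egf (\<lambda>k. of_nat j ^ k * W (j * n) k)"
  \<comment> \<open>Scalars appear as \<open>fps_const\<close>, so that
    \<open>fps_mult_left_const_nth\<close> can extract them when coefficients are compared.\<close>
  have "egf (W n) * egf (W n) * egf (W n) * egf (W n) =
      fps_const (- 6) * ?P 4 + fps_const 4 * (?P 3 * egf (W n)) + fps_const 3 * (?P 2 * ?P 2)
      + fps_const (12 / 44 ^ n) * (egf (W n) * egf (\<lambda>_. 1))"
  proof -
    have "fps_const (12 / 44 ^ n) * (egf (W n) * egf (\<lambda>_. 1)) = 12 * (a * b * c * (a + b + c))"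
      unfolding abc P1 numeral_fps_const by (simp add: mult_ac flip: fps_const_mult)
    moreover have "?P 4 = a ^ 4 + b ^ 4 + c ^ 4" "?P 3 = a ^ 3 + b ^ 3 + c ^ 3"
      "?P 2 = a ^ 2 + b ^ 2 + c ^ 2"
      by (rule power_sum; simp)+
    moreover have "fps_const (- 6) = (- 6 :: complex fps)" "fps_const 4 = (4 :: complex fps)"
      "fps_const 3 = (3 :: complex fps)"
      by (simp_all add: numeral_fps_const)
    ultimately show ?thesis
      by (simp only: P1 power_sum_identity)
  qed
  from arg_cong[OF this, of "\<lambda>F. fact m * fps_nth F m"]
  have main: "fact m * fps_nth (egf (W n) * egf (W n) * egf (W n) * egf (W n)) m =
      - 6 * (fact m * fps_nth (?P 4) m) + 4 * (fact m * fps_nth (?P 3 * egf (W n)) m)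
      + 3 * (fact m * fps_nth (?P 2 * ?P 2) m)
      + 12 / 44 ^ n * (fact m * fps_nth (egf (W n) * egf (\<lambda>_. 1)) m)"
    by (simp only: fps_add_nth fps_mult_left_const_nth distrib_left mult.left_commute[of "fact m"])
  have UW: "U k = A n * W n k" for k
    using A_nonzero[OF n] by (simp add: U W_def)
  have VW: "V j k = A (j * n) * W (j * n) k" if "j \<in> {2, 3, 4}" for j k
    using A_nonzero[of "j * n"] that n by (auto simp: V W_def)
  have nz: "A n \<noteq> 0" "A (2 * n) \<noteq> 0" "A (3 * n) \<noteq> 0" "A (4 * n) \<noteq> 0"
    using n by (auto intro!: A_nonzero)
  \<comment> \<open>Here and in \<open>R4\<close> to \<open>R1\<close> the prefactors in
    \<open>A\<close> cancel exactly those from \<open>UW\<close> and \<open>VW\<close>.\<close>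
  have L: "1 / A n ^ 4 *
      (\<Sum>(k1, k2, k3, k4) \<in> {(k1, k2, k3, k4). k1 + k2 + k3 + k4 = m}.
        multinomial m [k1, k2, k3, k4] * U k1 * U k2 * U k3 * U k4) =
      fact m * fps_nth (egf (W n) * egf (W n) * egf (W n) * egf (W n)) m"
    unfolding fact_mult_egf_mult4_nth sum_distrib_left
    by (rule sum.cong) (use nz in \<open>auto simp: UW power4_eq_xxxx\<close>)
  have R4: "- (6 * 4 ^ m / A (4 * n)) * V 4 m = - 6 * (fact m * fps_nth (?P 4) m)"
    using nz by (simp add: VW)
  have R3: "4 / (A (3 * n) * A n) * (\<Sum>k=0..m. of_nat (m choose k) * 3 ^ k * V 3 k * U (m - k)) =
      4 * (fact m * fps_nth (?P 3 * egf (W n)) m)"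
    unfolding fact_mult_egf_mult_nth sum_distrib_left
    by (rule sum.cong) (use nz in \<open>auto simp: UW VW\<close>)
  have R2: "3 / (A (2 * n)) ^ 2 *
      (\<Sum>k=0..m. of_nat (m choose k) * 2 ^ m * V 2 k * V 2 (m - k)) =
      3 * (fact m * fps_nth (?P 2 * ?P 2) m)"
    unfolding fact_mult_egf_mult_nth sum_distrib_left
  proof (rule sum.cong)
    fix k assume "k \<in> {0..m}"
    \<comment> \<open>The two factors \<open>?P 2\<close> contribute \<open>2 ^ k\<close> and
      \<open>2 ^ (m - k)\<close>, whose product does not depend on \<open>k\<close>.\<close>
    then have "(2::complex) ^ m = 2 ^ k * 2 ^ (m - k)"
      by (simp flip: power_add)
    then show "3 / (A (2 * n))\<^sup>2 * (of_nat (m choose k) * 2 ^ m * V 2 k * V 2 (m - k)) =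
        3 * (of_nat (m choose k) * (of_nat 2 ^ k * W (2 * n) k) *
          (of_nat 2 ^ (m - k) * W (2 * n) (m - k)))"
      using nz by (simp add: VW power2_eq_square)
  qed simp
  have R1: "12 / (44 ^ n * A n) * (\<Sum>k=0..m. of_nat (m choose k) * U k) =
      12 / 44 ^ n * (fact m * fps_nth (egf (W n) * egf (\<lambda>_. 1)) m)"
    unfolding fact_mult_egf_mult_nth sum_distrib_left
    by (rule sum.cong) (use nz in \<open>auto simp: UW\<close>)
  show ?thesis
    unfolding L R4 R3 R2 R1 by (rule main)
qed

end
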